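(* Fix an integer $N\ge1$ and distinct $N$-tuples $\mathbf{m}=(m_0<\cdots<m_{N-1})$ and $\mathbf{n}=(n_0<\cdots<n_{N-1})$ of real numbers with strictly increasing entries such that $m_j\le n_j$ for all $j$. The symmetric function $$f:(0,\infty)^N_{\neq}\to\mathbb{R};\quad\mathbf{u}\mapsto\frac{\det\mathbf{u}^{\circ\mathbf{n}}}{\det\mathbf{u}^{\circ\mathbf{m}}}$$ is strictly increasing in each coordinate and, for any $\rho\in(0,\infty)$, is bounded above by the constant $\rho^{|\mathbf{n}-\mathbf{m}|/2}\,V(\mathbf{n})/V(\mathbf{m})$ on $(0,\sqrt{\rho}]^N_{\neq}$. Furthermore, if $m_0=n_0=0$ then $f$ is well defined on $[0,\sqrt{\rho}]^N_{\neq}$ and these two properties hold there.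
   Context: For $S\subseteq\mathbb{R}$, $S^N_{\neq}$ is the set of $N$-tuples of pairwise distinct elements of $S$. For $\mathbf{u}=(u_1,\ldots,u_N)$ and $\mathbf{n}=(n_0,\ldots,n_{N-1})$, $\mathbf{u}^{\circ\mathbf{n}}:=(u_i^{n_{j-1}})_{i,j=1}^N$, with $0^0:=1$. $|\mathbf{n}-\mathbf{m}|:=\sum_{j=0}^{N-1}(n_j-m_j)$. For an $N$-tuple $\mathbf{a}=(a_1,\ldots,a_N)$, $V(\mathbf{a}):=\prod_{1\le k<l\le N}(a_l-a_k)$ (empty product equal to $1$). A function on $X\subseteq\mathbb{R}^N$ is strictly increasing in each coordinate if $f(\mathbf{u})<f(\mathbf{v})$ whenever $\mathbf{u},\mathbf{v}\in X$ differ in exactly one coordinate $i$ and $u_i<v_i$. *)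

theory Defs
  imports Complex_Main "Jordan_Normal_Form.Determinant"
begin

text \<open>Tuples are vectors of the Jordan-Normal-Form library; entries are indexed from 0, so the
  tuple $(u_1, \dots, u_N)$ is stored as \<open>u $ 0, \<dots>, u $ (N - 1)\<close>.\<close>

definition distinct_tuples :: "nat \<Rightarrow> real set \<Rightarrow> real vec set" where
  "distinct_tuples N S =
    {u \<in> carrier_vec N. (\<forall>i<N. u $ i \<in> S) \<and> (\<forall>i<N. \<forall>j<N. i \<noteq> j \<longrightarrow> u $ i \<noteq> u $ j)}"

text \<open>The library's \<open>powr\<close> has \<open>0 powr 0 = 0\<close>; here the convention is $0^0 = 1$.\<close>

definition real_pow :: "real \<Rightarrow> real \<Rightarrow> real" where
  "real_pow x a = (if x = 0 \<and> a = 0 then 1 else x powr a)"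

definition circ_power :: "real vec \<Rightarrow> real vec \<Rightarrow> real mat" where
  "circ_power u n = mat (dim_vec u) (dim_vec n) (\<lambda>(i, j). real_pow (u $ i) (n $ j))"

definition tuple_diff :: "real vec \<Rightarrow> real vec \<Rightarrow> real" where
  "tuple_diff n m = (\<Sum>j<dim_vec n. (n $ j - m $ j))"

definition vandermonde :: "real vec \<Rightarrow> real" where
  "vandermonde a = (\<Prod>l<dim_vec a. \<Prod>k<l. (a $ l - a $ k))"

definition det_ratio :: "real vec \<Rightarrow> real vec \<Rightarrow> real vec \<Rightarrow> real" where
  "det_ratio n m u = det (circ_power u n) / det (circ_power u m)"

definition strictly_increasing_coords :: "nat \<Rightarrow> real vec set \<Rightarrow> (real vec \<Rightarrow> real) \<Rightarrow> bool" where
  "strictly_increasing_coords N X f \<longleftrightarrow>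
    (\<forall>u\<in>X. \<forall>v\<in>X. \<forall>i<N.
      u $ i < v $ i \<and> (\<forall>j<N. j \<noteq> i \<longrightarrow> u $ j = v $ j) \<longrightarrow> f u < f v)"

definition symmetric_on :: "nat \<Rightarrow> real vec set \<Rightarrow> (real vec \<Rightarrow> real) \<Rightarrow> bool" where
  "symmetric_on N X f \<longleftrightarrow>
    (\<forall>u\<in>X. \<forall>\<sigma>. \<sigma> permutes {..<N} \<longrightarrow> f (vec N (\<lambda>i. u $ \<sigma> i)) = f u)"

end

theory Submission
  imports Defs
begin

text \<open>
  The proof rests on three facts about the determinants \<open>D(u; e) = det (u\<^sub>i ^ e\<^sub>j)\<close>, stated here for
  positive points.

  \<^item> \<^emph>\<open>Nonvanishing.\<close> By Rolle, a combination of \<open>N\<close> distinct real powers with \<open>N\<close> positive zeros is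
    trivial (\<open>real_exponent_sum_zero\<close>), so \<open>D(u; e) \<noteq> 0\<close> for distinct points and distinct exponents.

  \<^item> \<^emph>\<open>Sign.\<close> Deforming the exponents, in their given order, to the integers \<open>0, \<dots>, N - 1\<close> keeps \<open>D\<close>
    nonzero and ends at a Vandermonde determinant. Hence \<open>D(u; e)\<close> has the sign of \<open>V(u) V(e)\<close>,
    whatever the order of the points and of the exponents (\<open>kernel_det_real_pow_sign\<close>).

  \<^item> \<^emph>\<open>Condensation.\<close> For exponents \<open>e\<close> together with two more, \<open>a\<close> and \<open>b\<close>, and points \<open>u\<close> together
    with two more, \<open>x\<close> and \<open>y\<close>, the Desnanot-Jacobi identity reads
    \<open>D(u,x; e,a) D(u,y; e,b) - D(u,x; e,b) D(u,y; e,a) = D(u,x,y; e,a,b) D(u; e)\<close>.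

  The left-hand side of the identity is, up to the denominators, the increment from \<open>x\<close> to \<open>y\<close> of the
  ratio \<open>D(u,\<cdot>; e,b) / D(u,\<cdot>; e,a)\<close>, and the sign rule determines the sign of the right-hand side: the
  Vandermonde products cancel down to \<open>(y - x) (b - a) \<Prod>\<^sub>j (a - e\<^sub>j) (b - e\<^sub>j)\<close> times squares. So the ratio
  increases strictly when one exponent is raised from \<open>a\<close> to \<open>b\<close> without passing another one. One gets
  from \<open>m\<close> to \<open>n\<close> by such moves, the largest exponent first, and \<open>f\<close> is the product of the
  corresponding positive increasing ratios (\<open>kernel_det_ratio_strictly_increasing\<close>).

  For the upper bound, monotonicity allows replacing \<open>u\<close> by a geometric progression \<open>s r\<^sup>i\<close> with \<open>r > 1\<close>
  and \<open>s = r \<surd>\<rho>\<close>, whose members all exceed \<open>\<surd>\<rho>\<close>. There both determinants are, up to powers of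
  \<open>s\<close>, Vandermonde determinants in \<open>r\<close> raised to the exponents, so that \<open>f\<close> is an explicit product, which
  tends to the asserted constant as \<open>r\<close> decreases to 1.

  Points on the positive half-line and on the closed half-line are treated together: the points come
  from a set \<open>S\<close> of nonnegative reals, and if \<open>0\<close> belongs to \<open>S\<close>, then the exponents are nonnegative and
  one of them is 0 (\<open>exponents_for\<close>). A zero point then contributes a unit row.\<close>

section \<open>Zeros of sums of real powers\<close>

text \<open>Keeping the zeros of the derivative below \<open>Max T\<close> ensures, in the induction on the number of zeros,
  that the zero found in the last interval is a new one.\<close>

lemma finitely_many_Rolle:
  fixes g g' :: "real \<Rightarrow> real"
  assumes "\<And>x. x > 0 \<Longrightarrow> (g has_field_derivative g' x) (at x)"
    and "finite T" "card T = Suc n" "T \<subseteq> {0<..}" "\<And>x. x \<in> T \<Longrightarrow> g x = 0"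
  shows "\<exists>Z. finite Z \<and> Z \<subseteq> {0<..<Max T} \<and> card Z = n \<and> (\<forall>z\<in>Z. g' z = 0)"
  using assms(2-)
proof (induction n arbitrary: T)
  case 0
  show ?case by (rule exI[of _ "{}"]) simp
next
  case (Suc n)
  define b where "b = Max T"
  define T' where "T' = T - {b}"
  have b: "b \<in> T" "\<And>x. x \<in> T \<Longrightarrow> x \<le> b"
    using Suc.prems(1,2) by (auto simp: b_def intro!: Max_in)
  have T': "finite T'" "card T' = Suc n" "T' \<subseteq> {0<..}" "\<And>x. x \<in> T' \<Longrightarrow> g x = 0"
    using Suc.prems b by (auto simp: T'_def)
  define a where "a = Max T'"
  have a: "a \<in> T'" using T'(1,2) unfolding a_def by (intro Max_in) auto
  have ab: "0 < a" "a < b" "g a = g b"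
    using a b T'(3,4) Suc.prems(4) unfolding T'_def by force+
  obtain Z where Z: "finite Z" "Z \<subseteq> {0<..<a}" "card Z = n" "\<forall>z\<in>Z. g' z = 0"
    using Suc.IH[OF T'] a_def by auto
  have "\<exists>z. a < z \<and> z < b \<and> DERIV g z :> 0"
  proof (rule Rolle)
    show "continuous_on {a..b} g"
      by (rule DERIV_continuous_on[of _ _ g'], rule has_field_derivative_at_within, rule assms(1))
        (use ab in auto)
    show "g differentiable (at x)" if "a < x" "x < b" for x
      using ab that assms(1)[of x] by (auto simp: real_differentiable_def)
  qed (use ab in auto)
  then obtain z where z: "a < z" "z < b" "DERIV g z :> 0" by blast
  have "g' z = 0" using z ab assms(1)[of z] by (auto intro: DERIV_unique)
  moreover have "z \<notin> Z" using Z(2) z by auto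
  ultimately show ?case
    using Z z ab by (intro exI[of _ "insert z Z"]) (auto simp: b_def[symmetric])
qed

text \<open>A weak form of Descartes' rule of signs. Dividing by one of the powers makes that term constant,
  and differentiating removes it; this costs one zero and leaves a sum of the same kind with one term
  less.\<close>

lemma real_exponent_sum_zero:
  fixes c e :: "'j \<Rightarrow> real"
  assumes "finite J" "inj_on e J" "finite T" "T \<subseteq> {0<..}" "card J \<le> card T"
    and "\<And>x. x \<in> T \<Longrightarrow> (\<Sum>j\<in>J. c j * x powr e j) = 0"
  shows "\<forall>j\<in>J. c j = 0"
  using assms
proof (induction J arbitrary: c e T rule: finite_induct)
  case empty
  then show ?case by simp
next
  case (insert k J)
  define g where "g = (\<lambda>x. c k + (\<Sum>j\<in>J. c j * x powr (e j - e k)))"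
  define g' where "g' = (\<lambda>x. \<Sum>j\<in>J. (c j * (e j - e k)) * x powr (e j - e k - 1))"
  \<comment> \<open>Only as many zeros as terms are kept, since \<open>finitely_many_Rolle\<close> loses exactly one.\<close>
  obtain U where U: "U \<subseteq> T" "card U = Suc (card J)"
    using insert.prems(4) insert.hyps by (metis card_insert_disjoint obtain_subset_with_card_n)
  have finU: "finite U" using U by (meson finite_subset insert.prems(2))
  have g0: "g x = 0" if "x \<in> U" for x
  proof -
    have x: "x > 0" and s: "(\<Sum>j\<in>insert k J. c j * x powr e j) = 0"
      using that U insert.prems by auto
    have "x powr e k * g x = (\<Sum>j\<in>insert k J. c j * x powr e j)"
      using insert.hyps x
      by (simp add: g_def distrib_left sum_distrib_left mult.left_commute powr_add[symmetric])
    then show ?thesis using s x by simp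
  qed
  have "(g has_field_derivative g' x) (at x)" if "x > 0" for x
  proof -
    have "((\<lambda>x. c j * x powr (e j - e k)) has_field_derivative
        (c j * (e j - e k)) * x powr (e j - e k - 1)) (at x)" for j
      using DERIV_cmult[OF has_real_derivative_powr[OF that]] by (simp add: mult.assoc)
    then have "(g has_field_derivative 0 + g' x) (at x)"
      unfolding g_def g'_def by (intro DERIV_add DERIV_const DERIV_sum)
    then show ?thesis by simp
  qed
  then obtain Z where Z: "finite Z" "Z \<subseteq> {0<..<Max U}" "card Z = card J" "\<forall>z\<in>Z. g' z = 0"
    using finitely_many_Rolle[of g g' U "card J"] finU U g0 insert.prems(3) by blast
  have "\<forall>j\<in>J. c j * (e j - e k) = 0"
  proof (rule insert.IH[where e = "\<lambda>j. e j - e k - 1" and T = Z])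
    show "inj_on (\<lambda>j. e j - e k - 1) J"
      using insert.prems(1) by (auto simp: inj_on_def)
    show "(\<Sum>j\<in>J. c j * (e j - e k) * x powr (e j - e k - 1)) = 0" if "x \<in> Z" for x
      using Z(4) that by (simp add: g'_def)
  qed (use Z in auto)
  then have cJ: "\<forall>j\<in>J. c j = 0" using insert.prems(1) insert.hyps by (auto simp: inj_on_def)
  moreover obtain x where "x \<in> U" using U by fastforce
  ultimately have "c k = 0" using g0[of x] by (simp add: g_def)
  then show ?case using cJ by simp
qed

section \<open>Determinants of kernel matrices\<close>

text \<open>Rows and columns are labelled by functions on \<^typ>\<open>nat\<close>, so that adjoining a row or a column is a
  function update at the index \<open>N\<close>.\<close>

definition kernel_det :: "('r \<Rightarrow> 'c \<Rightarrow> 'a::comm_ring_1) \<Rightarrow> nat \<Rightarrow> (nat \<Rightarrow> 'r) \<Rightarrow> (nat \<Rightarrow> 'c) \<Rightarrow> 'a" where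
  "kernel_det k N u e = det (mat N N (\<lambda>(i, j). k (u i) (e j)))"

lemma kernel_det_cong:
  assumes "\<And>i j. i < N \<Longrightarrow> j < N \<Longrightarrow> k (u i) (e j) = k' (u' i) (e' j)"
  shows "kernel_det k N u e = kernel_det k' N u' e'"
  unfolding kernel_det_def by (intro arg_cong[of _ _ det] cong_mat) (use assms in auto)

lemma kernel_det_swap_arguments:
  "kernel_det k N u e = kernel_det (\<lambda>y x. k x y) N e u"
proof -
  have "transpose_mat (mat N N (\<lambda>(i, j). k (u i) (e j))) = mat N N (\<lambda>(i, j). k (u j) (e i))"
    by (intro eq_matI) auto
  then show ?thesis
    unfolding kernel_det_def by (metis det_transpose mat_carrier)
qed

lemma kernel_det_permute_rows:
  assumes "p permutes {..<N}"
  shows "kernel_det k N (u \<circ> p) e = signof p * kernel_det k N u e"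
proof -
  let ?A = "mat N N (\<lambda>(i, j). k (u i) (e j))"
  have "mat N N (\<lambda>(i, j). k ((u \<circ> p) i) (e j)) = mat N N (\<lambda>(i, j). ?A $$ (p i, j))"
    using permutes_in_image[OF assms] by (intro cong_mat) auto
  then show ?thesis
    unfolding kernel_det_def
    using det_permute_rows[of ?A N p] assms by (simp add: lessThan_atLeast0)
qed

lemma kernel_det_permute_columns:
  assumes "p permutes {..<N}"
  shows "kernel_det k N u (e \<circ> p) = signof p * kernel_det k N u e"
  using kernel_det_permute_rows[OF assms, of "\<lambda>y x. k x y" e u]
  by (metis kernel_det_swap_arguments)

lemma kernel_det_scale_rows:
  "kernel_det (\<lambda>x y. c x * k x y) N u e = (\<Prod>i<N. c (u i)) * kernel_det k N u e"
proof -
  have "signof p * (\<Prod>i = 0..<N. c (u i) * k (u i) (e (p i)))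
      = (\<Prod>i<N. c (u i)) * (signof p * (\<Prod>i = 0..<N. k (u i) (e (p i))))" for p
    by (simp add: prod.distrib lessThan_atLeast0 ac_simps)
  then show ?thesis
    unfolding kernel_det_def
    by (subst (1 2) det_def'[of _ N])
      (auto simp: sum_distrib_left permutes_in_image intro!: sum.cong prod.cong)
qed

lemma kernel_det_repeated_row:
  assumes "i < N" "j < N" "i \<noteq> j" "u i = u j"
  shows "kernel_det k N u e = 0"
  unfolding kernel_det_def
  by (rule det_identical_rows[of _ N i j]) (use assms in auto)

text \<open>As a function of the last row label, the determinant lies in the span of the column functions
  \<open>\<lambda>x. k x (e j)\<close>; the coefficient of the last one is the determinant without last row and column.\<close>

lemma kernel_det_last_row_expansion:
  fixes k :: "'r \<Rightarrow> 'c \<Rightarrow> 'a::comm_ring_1"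
  obtains C where "C N = kernel_det k N u e"
    and "\<And>x. kernel_det k (Suc N) (u(N := x)) e = (\<Sum>j\<le>N. C j * k x (e j))"
proof -
  define M where "M x = mat (Suc N) (Suc N) (\<lambda>(i, j). k ((u(N := x)) i) (e j))" for x
  define C where "C j = cofactor (M undefined) N j" for j
  have del: "mat_delete (M x) N j = mat_delete (M undefined) N j" for x j
    by (intro eq_matI) (auto simp: mat_delete_def M_def)
  have "mat_delete (M undefined) N N = mat N N (\<lambda>(i, j). k (u i) (e j))"
    by (intro eq_matI) (auto simp: mat_delete_def M_def)
  then have "C N = kernel_det k N u e"
    by (simp add: C_def cofactor_def kernel_det_def flip: mult_2)
  moreover have "kernel_det k (Suc N) (u(N := x)) e = (\<Sum>j\<le>N. C j * k x (e j))" for x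
  proof -
    have "det (M x) = (\<Sum>j<Suc N. M x $$ (N, j) * cofactor (M x) N j)"
      by (rule laplace_expansion_row) (auto simp: M_def)
    also have "\<dots> = (\<Sum>j\<le>N. C j * k x (e j))"
      unfolding C_def cofactor_def del[of x] lessThan_Suc_atMost
      by (intro sum.cong) (auto simp: M_def mult.commute)
    finally show ?thesis by (simp add: M_def kernel_det_def)
  qed
  ultimately show ?thesis using that by blast
qed

text \<open>This turns bounds on the number of zeros into nonvanishing of determinants: a vector in the kernel of
  the matrix is a combination of the column functions \<open>\<lambda>x. k x (e j)\<close> that vanishes at all row labels.\<close>

lemma kernel_det_eq_0_iff:
  fixes k :: "'r \<Rightarrow> 'c \<Rightarrow> 'a::field"
  shows "kernel_det k N u e = 0 \<longleftrightarrow>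
    (\<exists>c. (\<exists>j<N. c j \<noteq> 0) \<and> (\<forall>i<N. (\<Sum>j<N. c j * k (u i) (e j)) = 0))"
proof -
  let ?A = "mat N N (\<lambda>(i, j). k (u i) (e j))"
  have prod: "(?A *\<^sub>v v) $ i = (\<Sum>j<N. v $ j * k (u i) (e j))" if "i < N" "v \<in> carrier_vec N" for i v
    using that by (auto simp: scalar_prod_def lessThan_atLeast0 mult.commute intro!: sum.cong)
  have *: "?A *\<^sub>v v = 0\<^sub>v N \<longleftrightarrow> (\<forall>i<N. (\<Sum>j<N. v $ j * k (u i) (e j)) = 0)"
    if "v \<in> carrier_vec N" for v
    using prod that by (auto simp: vec_eq_iff)
  have "kernel_det k N u e = 0 \<longleftrightarrow> (\<exists>v. v \<in> carrier_vec N \<and> v \<noteq> 0\<^sub>v N \<and> ?A *\<^sub>v v = 0\<^sub>v N)"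
    unfolding kernel_det_def by (rule det_0_iff_vec_prod_zero) simp
  also have "\<dots> \<longleftrightarrow> (\<exists>c. (\<exists>j<N. c j \<noteq> 0) \<and> (\<forall>i<N. (\<Sum>j<N. c j * k (u i) (e j)) = 0))" (is "?L = ?R")
  proof
    assume ?L
    then obtain v where "v \<in> carrier_vec N" "v \<noteq> 0\<^sub>v N" "?A *\<^sub>v v = 0\<^sub>v N" by blast
    then show ?R using * by (intro exI[of _ "\<lambda>j. v $ j"]) (auto simp: vec_eq_iff)
  next
    assume ?R
    then obtain c where c: "\<exists>j<N. c j \<noteq> 0" "\<forall>i<N. (\<Sum>j<N. c j * k (u i) (e j)) = 0" by blast
    have "vec N c \<noteq> 0\<^sub>v N" using c(1) by (auto simp: vec_eq_iff)
    moreover have "?A *\<^sub>v vec N c = 0\<^sub>v N" using c(2) by (subst *) auto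
    ultimately show ?L by (intro exI[of _ "vec N c"]) auto
  qed
  finally show ?thesis .
qed

text \<open>The Desnanot-Jacobi identity. As functions of \<open>y\<close>, both sides are combinations of the columns
  \<open>e\<close>, \<open>a\<close>, \<open>b\<close> with the same coefficient at \<open>b\<close>. Their difference is thus a combination of the \<open>N + 1\<close>
  columns \<open>e\<close>, \<open>a\<close>, and it vanishes at the \<open>N + 1\<close> rows \<open>u\<close>, \<open>x\<close>, because every determinant then has a
  repeated row or the two products coincide. By the assumption that these rows and columns have a nonzero
  determinant, it is zero.\<close>

lemma kernel_det_condensation:
  fixes k :: "'r \<Rightarrow> 'c \<Rightarrow> 'a::field"
  assumes nz: "kernel_det k (Suc N) (u(N := x)) (e(N := a)) \<noteq> 0"
  shows "kernel_det k (Suc (Suc N)) (u(N := x, Suc N := y)) (e(N := a, Suc N := b)) * kernel_det k N u e =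
    kernel_det k (Suc N) (u(N := x)) (e(N := a)) * kernel_det k (Suc N) (u(N := y)) (e(N := b)) -
    kernel_det k (Suc N) (u(N := x)) (e(N := b)) * kernel_det k (Suc N) (u(N := y)) (e(N := a))"
proof -
  define F where "F c z = kernel_det k (Suc N) (u(N := z)) (e(N := c))" for c z
  define G where "G z = kernel_det k (Suc (Suc N)) (u(N := x, Suc N := z)) (e(N := a, Suc N := b))" for z
  define D where "D = kernel_det k N u e"
  define H where "H z = G z * D - (F a x * F b z - F b x * F a z)" for z
  have last: "kernel_det k N u (e(N := c)) = D" for c
    unfolding D_def by (rule kernel_det_cong) simp
  obtain A where A: "A N = D" "\<And>z. F a z = (\<Sum>j\<le>N. A j * k z ((e(N := a)) j))"
    using kernel_det_last_row_expansion[of N k u "e(N := a)"] last unfolding F_def by metis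
  obtain B where B: "B N = D" "\<And>z. F b z = (\<Sum>j\<le>N. B j * k z ((e(N := b)) j))"
    using kernel_det_last_row_expansion[of N k u "e(N := b)"] last unfolding F_def by metis
  have "kernel_det k (Suc N) (u(N := x)) (e(N := a, Suc N := b)) = F a x"
    unfolding F_def by (rule kernel_det_cong) auto
  then obtain C where C: "C (Suc N) = F a x"
      "\<And>z. G z = (\<Sum>j\<le>Suc N. C j * k z ((e(N := a, Suc N := b)) j))"
    using kernel_det_last_row_expansion[of "Suc N" k "u(N := x)" "e(N := a, Suc N := b)"]
    unfolding G_def by metis
  \<comment> \<open>the coefficients of \<open>H\<close>; index \<open>N\<close> stands for the column \<open>a\<close>, to which \<open>F a x * F b z\<close> does
     not contribute\<close>
  define h where "h j = (if j < N then C j * D - (F a x * B j - F b x * A j) else C N * D + F b x * A N)" for j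
  have H_expansion: "H z = (\<Sum>j<Suc N. h j * k z ((e(N := a)) j))" for z
  proof -
    have "F a z = (\<Sum>j<N. A j * k z (e j)) + D * k z a"
      "F b z = (\<Sum>j<N. B j * k z (e j)) + D * k z b"
      "G z = (\<Sum>j<N. C j * k z (e j)) + C N * k z a + F a x * k z b"
      using A B C by (simp_all add: lessThan_Suc_atMost[symmetric])
    moreover have "(\<Sum>j<N. h j * k z (e j)) = (\<Sum>j<N. C j * k z (e j)) * D
        - (F a x * (\<Sum>j<N. B j * k z (e j)) - F b x * (\<Sum>j<N. A j * k z (e j)))"
      unfolding sum_distrib_left sum_distrib_right sum_subtractf[symmetric]
      by (intro sum.cong) (auto simp: h_def algebra_simps)
    ultimately show ?thesis
      by (simp add: H_def h_def A(1) algebra_simps)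
  qed
  have "H ((u(N := x)) i) = 0" if "i < Suc N" for i
  proof (cases "i = N")
    case True
    have "G x = 0"
      unfolding G_def by (rule kernel_det_repeated_row[of N _ "Suc N"]) auto
    then show ?thesis using True by (simp add: H_def)
  next
    case False
    then have "i < N" using that by simp
    then have "G (u i) = 0"
      unfolding G_def by (intro kernel_det_repeated_row[of i _ "Suc N"]) auto
    moreover have "F c (u i) = 0" for c
      unfolding F_def using \<open>i < N\<close> by (intro kernel_det_repeated_row[of i _ N]) auto
    ultimately show ?thesis using False by (simp add: H_def)
  qed
  then have "\<forall>j<Suc N. h j = 0"
    using nz unfolding kernel_det_eq_0_iff[of k "Suc N"] H_expansion by blast
  then have "H y = 0" unfolding H_expansion by (intro sum.neutral) auto
  then show ?thesis by (simp add: H_def F_def G_def D_def)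
qed

section \<open>Vandermonde determinants\<close>

text \<open>The Vandermonde product of functions, so that one can pass between different numbers of points.\<close>

definition vandermonde_prod :: "nat \<Rightarrow> (nat \<Rightarrow> real) \<Rightarrow> real" where
  "vandermonde_prod N a = (\<Prod>l<N. \<Prod>k<l. a l - a k)"

lemma vandermonde_prod_cong: "(\<And>i. i < N \<Longrightarrow> a i = b i) \<Longrightarrow> vandermonde_prod N a = vandermonde_prod N b"
  unfolding vandermonde_prod_def by (intro prod.cong) auto

lemma vandermonde_prod_Suc_upd:
  "vandermonde_prod (Suc N) (a(N := x)) = vandermonde_prod N a * (\<Prod>k<N. x - a k)"
  unfolding vandermonde_prod_def by (auto intro!: prod.cong arg_cong2[of _ _ _ _ "(*)"])

lemma vandermonde_prod_pos: "strict_mono_on {..<N} a \<Longrightarrow> vandermonde_prod N a > 0"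
  unfolding vandermonde_prod_def by (intro prod_pos) (auto simp: strict_mono_on_def)

lemma vandermonde_prod_nonzero: "inj_on a {..<N} \<Longrightarrow> vandermonde_prod N a \<noteq> 0"
  unfolding vandermonde_prod_def by (force simp: inj_on_def)

text \<open>With the other points fixed, the determinant and \<open>V(a) \<Prod>\<^sub>i (x - a\<^sub>i)\<close> are polynomials of degree at
  most \<open>N\<close> in the last point \<open>x\<close> with the same coefficient at \<open>x\<^sup>N\<close> and \<open>N\<close> common zeros, hence equal.\<close>

lemma kernel_det_Vandermonde:
  assumes "inj_on a {..<N}"
  shows "kernel_det (^) N a id = vandermonde_prod N a"
  using assms
proof (induction N)
  case 0
  then show ?case by (simp add: kernel_det_def vandermonde_prod_def)
next
  case (Suc N)
  have inj: "inj_on a {..<N}" using Suc.prems by (auto simp: inj_on_def)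
  obtain C where C: "C N = kernel_det (^) N a id"
      "\<And>x. kernel_det (^) (Suc N) (a(N := x)) id = (\<Sum>j\<le>N. C j * x ^ id j)"
    using kernel_det_last_row_expansion[of N "(^)" a id] by blast
  have CN: "C N = vandermonde_prod N a" using Suc.IH[OF inj] C(1) by (rule trans[rotated])
  define p where "p = (\<Sum>j\<le>N. monom (C j) j)"
  define q where "q = smult (vandermonde_prod N a) (\<Prod>i<N. [:- a i, 1:])"
  have poly_p: "poly p x = kernel_det (^) (Suc N) (a(N := x)) id" for x
    by (simp add: p_def C(2) poly_sum poly_monom)
  have poly_q: "poly q x = vandermonde_prod N a * (\<Prod>k<N. x - a k)" for x
    by (simp add: q_def poly_prod)
  have deg: "degree (\<Prod>i<N. [:- a i, 1:]) = N" by (subst degree_prod_eq_sum_degree) auto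
  have lead: "coeff (\<Prod>i<N. [:- a i, 1:]) N = 1"
    using lead_coeff_prod[of "\<lambda>i. [:- a i, 1:]" "{..<N}"] deg by simp
  have "p = q"
  proof (rule poly_eqI_degree_lead_coeff[of _ N _ "a ` {..<N}"])
    show "coeff p N = coeff q N"
      by (simp add: p_def q_def coeff_sum lead CN if_distrib[of "(*) _"] cong: if_cong)
    show "N \<le> card (a ` {..<N})" using inj by (simp add: card_image)
    show "degree p \<le> N"
      unfolding p_def by (intro degree_sum_le) (auto intro: order.trans[OF degree_monom_le])
    show "degree q \<le> N" 
      unfolding q_def using deg degree_smult_le[of "vandermonde_prod N a" "\<Prod>i<N. [:- a i, 1:]"] by simp
    fix z assume "z \<in> a ` {..<N}"
    then obtain i where i: "i < N" "z = a i" by auto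
    have "poly p z = 0"
      unfolding poly_p i using i(1) by (intro kernel_det_repeated_row[of i _ N]) auto
    moreover have "poly q z = 0" unfolding poly_q i using i(1) by auto
    ultimately show "poly p z = poly q z" by simp
  qed
  then have "poly p (a N) = poly q (a N)" by simp
  then show ?case
    using vandermonde_prod_Suc_upd[of N a "a N"] unfolding poly_p poly_q by (simp only: fun_upd_triv)
qed

section \<open>Determinants of real powers\<close>

text \<open>Exponents for which no choice of distinct points in \<open>S \<subseteq> [0, \<infinity>)\<close> makes the determinant vanish. The
  value of \<^const>\<open>real_pow\<close> at base 0 is 1 for the exponent 0 and 0 for all others, so a zero point gives a
  zero row unless 0 is among the exponents; negative exponents have no meaning there.\<close>

definition exponents_for :: "real set \<Rightarrow> nat \<Rightarrow> (nat \<Rightarrow> real) \<Rightarrow> bool" where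
  "exponents_for S N e \<longleftrightarrow> inj_on e {..<N} \<and>
     (0 \<in> S \<longrightarrow> (\<forall>j<N. 0 \<le> e j) \<and> (\<exists>j<N. e j = 0))"

lemma real_pow_pos: "x > 0 \<Longrightarrow> real_pow x a = x powr a"
  by (simp add: real_pow_def)

lemma real_pow_of_nat: "x \<ge> 0 \<Longrightarrow> real_pow x (real k) = x ^ k"
  by (cases "x = 0") (auto simp: real_pow_def powr_realpow)

text \<open>A combination of the columns that vanishes at all points is trivial, by the bound on positive zeros.
  If one of the points is 0, its value there is the coefficient of the exponent 0, so this coefficient
  vanishes, and the other coefficients face the other points, which are positive.\<close>

lemma kernel_det_real_pow_nonzero:
  assumes S: "S \<subseteq> {0..}" and e: "exponents_for S N e"
    and u: "u ` {..<N} \<subseteq> S" "inj_on u {..<N}"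
  shows "kernel_det real_pow N u e \<noteq> 0"
proof
  assume "kernel_det real_pow N u e = 0"
  then obtain c where c: "\<exists>j<N. c j \<noteq> 0" "\<And>i. i < N \<Longrightarrow> (\<Sum>j<N. c j * real_pow (u i) (e j)) = 0"
    unfolding kernel_det_eq_0_iff by blast
  have inj: "inj_on e {..<N}" using e by (simp add: exponents_for_def)
  have "\<forall>j<N. c j = 0"
  proof (cases "\<exists>i<N. u i = 0")
    case False
    then have pos: "u i > 0" if "i < N" for i using u(1) S that by force
    have "\<forall>j\<in>{..<N}. c j = 0"
    proof (rule real_exponent_sum_zero[of _ e "u ` {..<N}"])
      show "card {..<N} \<le> card (u ` {..<N})" using u(2) by (simp add: card_image)
      show "(\<Sum>j<N. c j * x powr e j) = 0" if "x \<in> u ` {..<N}" for x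
        using c(2) pos that by (auto simp: real_pow_pos)
    qed (use inj pos in auto)
    then show ?thesis by simp
  next
    case True
    then obtain i0 where i0: "i0 < N" "u i0 = 0" by blast
    then have "0 \<in> S" using u(1) by force
    then obtain j0 where j0: "j0 < N" "e j0 = 0" and e_nonneg: "\<forall>j<N. 0 \<le> e j"
      using e unfolding exponents_for_def by blast
    have pos: "u i > 0" if "i < N" "i \<noteq> i0" for i
    proof -
      have "u i \<noteq> u i0" using that i0 u(2) by (auto simp: inj_on_def)
      then show ?thesis using u(1) S that i0 by force
    qed
    have e_pos: "e j > 0" if "j < N" "j \<noteq> j0" for j
    proof -
      have "e j \<noteq> e j0" using that j0 inj by (auto simp: inj_on_def)
      then show ?thesis using e_nonneg that j0 by force
    qed
    have "real_pow (u i0) (e j) = (if j = j0 then 1 else 0)" if "j < N" for j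
      using e_pos[of j] j0 i0 that by (cases "j = j0") (auto simp: real_pow_def)
    then have "(\<Sum>j<N. c j * real_pow (u i0) (e j)) = (\<Sum>j<N. if j = j0 then c j else 0)"
      by (intro sum.cong) auto
    also have "\<dots> = c j0" using j0 by simp
    finally have "(\<Sum>j<N. c j * real_pow (u i0) (e j)) = c j0" .
    then have cj0: "c j0 = 0" using c(2)[OF i0(1)] by simp
    have "\<forall>j\<in>{..<N} - {j0}. c j = 0"
    proof (rule real_exponent_sum_zero[of _ e "u ` ({..<N} - {i0})"])
      show "inj_on e ({..<N} - {j0})" using inj by (auto simp: inj_on_def)
      have "inj_on u ({..<N} - {i0})" using u(2) by (auto simp: inj_on_def)
      then show "card ({..<N} - {j0}) \<le> card (u ` ({..<N} - {i0}))"
        using i0 j0 by (simp add: card_image)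
      show "(\<Sum>j\<in>{..<N} - {j0}. c j * x powr e j) = 0" if x: "x \<in> u ` ({..<N} - {i0})" for x
      proof -
        obtain i where i: "i < N" "i \<noteq> i0" "x = u i" using x by auto
        have "(\<Sum>j<N. c j * real_pow (u i) (e j)) = (\<Sum>j\<in>{..<N} - {j0}. c j * x powr e j)"
          using j0 cj0 i pos by (subst sum.remove[of _ j0]) (auto simp: real_pow_pos)
        then show ?thesis using c(2) i by simp
      qed
    qed (use pos in auto)
    then show ?thesis using cj0 by auto
  qed
  then show False using c(1) by blast
qed

lemma continuous_on_kernel_det:
  assumes "\<And>i j. i < N \<Longrightarrow> j < N \<Longrightarrow> continuous_on T (\<lambda>t. k (u i) (e t j) :: real)"
  shows "continuous_on T (\<lambda>t. kernel_det k N u (e t))"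
proof -
  have "kernel_det k N u (e t) =
      (\<Sum>p | p permutes {0..<N}. signof p * (\<Prod>i = 0..<N. k (u i) (e t (p i))))" for t
    unfolding kernel_det_def
    by (subst det_def'[of _ N]) (auto intro!: sum.cong prod.cong simp: permutes_in_image)
  then show ?thesis
    using assms by (auto intro!: continuous_intros simp: permutes_in_image)
qed

text \<open>The left-hand side is nonzero along every path of admissible exponents. The path goes linearly from
  \<open>e\<close> to the ranks of its entries; being order preserving, it keeps the exponents distinct and fixes an
  exponent 0 that is the smallest one. At its end, the determinant and the Vandermonde product of the
  exponents are permuted Vandermonde determinants, and the sign of the permutation occurs in both.\<close>

lemma kernel_det_real_pow_sign:
  assumes S: "S \<subseteq> {0..}" and e: "exponents_for S N e"
    and u: "u ` {..<N} \<subseteq> S" "inj_on u {..<N}"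
  shows "kernel_det real_pow N u e * vandermonde_prod N u * vandermonde_prod N e > 0"
proof -
  have inj: "inj_on e {..<N}" using e by (simp add: exponents_for_def)
  define r where "r j = card {k. k < N \<and> e k < e j}" for j
  have r_mono: "r i < r j" if "i < N" "e i < e j" for i j
    unfolding r_def using that by (intro psubset_card_mono) auto
  have r_less: "r j < N" if "j < N" for j
  proof -
    have "r j < card {..<N}" unfolding r_def using that by (intro psubset_card_mono) auto
    then show ?thesis by simp
  qed
  have r_inj: "inj_on r {..<N}"
  proof (rule inj_onI)
    fix i j assume "i \<in> {..<N}" "j \<in> {..<N}" "r i = r j"
    then have "e i = e j" using r_mono[of i j] r_mono[of j i] by fastforce
    then show "i = j" using inj \<open>i \<in> {..<N}\<close> \<open>j \<in> {..<N}\<close> by (auto simp: inj_on_def)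
  qed
  define p where "p j = (if j < N then r j else j)" for j
  have p: "p permutes {..<N}"
  proof (rule bij_imp_permutes)
    have "inj_on p {..<N}" using r_inj by (auto simp: inj_on_def p_def)
    moreover have "p ` {..<N} \<subseteq> {..<N}" using r_less by (auto simp: p_def)
    ultimately show "bij_betw p {..<N} {..<N}"
      using endo_inj_surj[of "{..<N}" p] by (simp add: bij_betw_def)
  qed (auto simp: p_def)
  define E where "E t j = (1 - t) * e j + t * real (p j)" for t j
  have E_mono: "E t i < E t j" if "t \<in> {0..1}" "i < N" "j < N" "e i < e j" for t i j
  proof (cases "t = 1")
    case True
    then show ?thesis using r_mono that by (simp add: E_def p_def)
  next
    case False
    then have "(1 - t) * e i < (1 - t) * e j" "t * real (p i) \<le> t * real (p j)"
      using that r_mono[of i j] by (auto simp: p_def intro!: mult_left_mono)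
    then show ?thesis by (simp add: E_def)
  qed
  have E_zero: "E t j = 0" if "0 \<in> S" "j < N" "e j = 0" for t j
  proof -
    have "\<forall>k<N. 0 \<le> e k" using e that(1) by (simp add: exponents_for_def)
    then have "{k. k < N \<and> e k < e j} = {}" using that(3) by force
    then have "p j = 0" unfolding p_def r_def using that(2) by simp
    then show ?thesis using that by (simp add: E_def)
  qed
  have E_pos: "E t j > 0" if zero: "0 \<in> S" "j < N" and "e j \<noteq> 0" "t \<in> {0..1}" for t j
  proof -
    obtain j0 where j0: "j0 < N" "e j0 = 0" "0 \<le> e j"
      using e zero unfolding exponents_for_def by blast
    then have "E t j0 < E t j" using zero that by (intro E_mono) auto
    then show ?thesis using E_zero[of j0 t] j0 zero that by simp
  qed
  have E_exponents: "exponents_for S N (E t)" if t: "t \<in> {0..1}" for t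
  proof -
    have "inj_on (E t) {..<N}"
    proof (rule inj_onI)
      fix i j assume ij: "i \<in> {..<N}" "j \<in> {..<N}" "E t i = E t j"
      then have "e i = e j" using E_mono[OF t, of i j] E_mono[OF t, of j i] by fastforce
      then show "i = j" using inj ij by (auto simp: inj_on_def)
    qed
    moreover have "(\<forall>j<N. 0 \<le> E t j) \<and> (\<exists>j<N. E t j = 0)" if "0 \<in> S"
    proof
      show "\<forall>j<N. 0 \<le> E t j"
        using E_pos[OF that _ _ t] E_zero[OF that] by (metis less_le order_refl)
      show "\<exists>j<N. E t j = 0" using e that E_zero by (auto simp: exponents_for_def)
    qed
    ultimately show ?thesis by (simp add: exponents_for_def)
  qed
  define g where "g t = kernel_det real_pow N u (E t) * vandermonde_prod N u * vandermonde_prod N (E t)" for t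
  \<comment> \<open>\<^const>\<open>real_pow\<close> jumps at base 0 where the exponent becomes 0; this does not happen here, since an
     exponent is either 0 or positive during the whole deformation.\<close>
  have "continuous_on {0..1} (\<lambda>t. real_pow (u i) (E t j))" if ij: "i < N" "j < N" for i j
  proof (cases "u i = 0")
    case True
    then have "0 \<in> S" using u(1) ij by force
    have "real_pow (u i) (E t j) = (if e j = 0 then 1 else 0)" if "t \<in> {0..1}" for t
      using E_zero[of j t] E_pos[of j t] \<open>0 \<in> S\<close> ij that True by (cases "e j = 0") (auto simp: real_pow_def)
    then show ?thesis by (subst continuous_on_cong[OF refl]) auto
  next
    case False
    then have "u i > 0" using u(1) S ij by force
    then show ?thesis by (auto simp: real_pow_pos E_def intro!: continuous_intros)
  qed
  then have g_cont: "continuous_on {0..1} g"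
    unfolding g_def vandermonde_prod_def
    by (intro continuous_intros continuous_on_kernel_det) (auto simp: E_def intro!: continuous_intros)
  have g_nonzero: "g t \<noteq> 0" if "t \<in> {0..1}" for t
    using kernel_det_real_pow_nonzero[OF S E_exponents[OF that] u] vandermonde_prod_nonzero[OF u(2)]
      vandermonde_prod_nonzero[of "E t" N] E_exponents[OF that]
    by (simp add: g_def exponents_for_def)
  have "g 1 > 0"
  proof -
    have "kernel_det real_pow N u (E 1) = kernel_det (^) N u (id \<circ> p)"
      using u(1) S by (intro kernel_det_cong) (force simp: E_def real_pow_of_nat)
    also have "\<dots> = signof p * vandermonde_prod N u"
      by (simp only: kernel_det_permute_columns[OF p] kernel_det_Vandermonde[OF u(2)])
    finally have 1: "kernel_det real_pow N u (E 1) = signof p * vandermonde_prod N u" .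
    have real_inj: "inj_on real {..<N}" by (simp add: inj_on_def)
    have "inj_on (real \<circ> p) {..<N}"
      using p by (auto simp: inj_on_def dest: permutes_inj injD)
    then have "vandermonde_prod N (E 1) = kernel_det (^) N (real \<circ> p) id"
      by (subst kernel_det_Vandermonde) (auto simp: E_def intro: vandermonde_prod_cong)
    also have "\<dots> = signof p * vandermonde_prod N real"
      by (simp only: kernel_det_permute_rows[OF p] kernel_det_Vandermonde[OF real_inj])
    finally have "g 1 = (signof p * signof p) * (vandermonde_prod N u * vandermonde_prod N u) * vandermonde_prod N real"
      unfolding g_def 1 by (simp add: ac_simps)
    moreover have "signof p * signof p = (1::real)" by (simp add: sign_def)
    moreover have "vandermonde_prod N real > 0" by (intro vandermonde_prod_pos) (simp add: strict_mono_on_def)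
    moreover have "vandermonde_prod N u * vandermonde_prod N u > 0"
      using vandermonde_prod_nonzero[OF u(2)] by (auto simp: zero_less_mult_iff not_less_iff_gr_or_eq)
    ultimately show ?thesis by simp
  qed
  have "g 0 > 0"
  proof (rule ccontr)
    assume "\<not> g 0 > 0"
    then obtain t where "t \<in> {0..1}" "g t = 0"
      using IVT'[of g 0 0 1] \<open>g 1 > 0\<close> g_cont by auto
    then show False using g_nonzero by blast
  qed
  moreover have "E 0 = e" by (auto simp: E_def)
  ultimately show ?thesis by (simp add: g_def)
qed

section \<open>Monotonicity of ratios\<close>

lemma inj_on_upd_last:
  assumes "inj_on f {..<N}" "\<And>i. i < N \<Longrightarrow> f i \<noteq> x"
  shows "inj_on (f(N := x)) {..<Suc N}"
proof (rule inj_onI)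
  fix i j assume "i \<in> {..<Suc N}" "j \<in> {..<Suc N}" "(f(N := x)) i = (f(N := x)) j"
  then show "i = j"
    using assms inj_onD[OF assms(1), of i j]
    by (cases "i = N"; cases "j = N") (auto simp: less_Suc_eq)
qed

lemma exponents_for_strict_mono:
  assumes "strict_mono_on {..<N} e" "0 \<in> S \<Longrightarrow> N > 0 \<and> e 0 = 0"
  shows "exponents_for S N e"
proof -
  have "0 \<le> e j" if "0 \<in> S" "j < N" for j
    using assms(2) that strict_mono_onD[OF assms(1), of 0 j] by (cases "j = 0") auto
  then show ?thesis
    using assms by (auto simp: exponents_for_def intro: strict_mono_on_imp_inj_on)
qed

lemma exponents_for_extend:
  assumes "exponents_for S N e" "\<And>j. j < N \<Longrightarrow> a \<noteq> e j" "0 \<in> S \<Longrightarrow> 0 \<le> a"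
  shows "exponents_for S (Suc N) (e(N := a))"
proof -
  have "inj_on (e(N := a)) {..<Suc N}"
    using assms(1,2) by (intro inj_on_upd_last) (auto simp: exponents_for_def)
  moreover have "\<exists>j<Suc N. (e(N := a)) j = 0" if zero: "0 \<in> S"
  proof -
    obtain j where "j < N" "e j = 0" using assms(1) zero unfolding exponents_for_def by blast
    then show ?thesis by (intro exI[of _ j]) auto
  qed
  ultimately show ?thesis using assms(1,3) by (auto simp: exponents_for_def less_Suc_eq)
qed

text \<open>The product condition says that no \<open>e j\<close> lies between \<open>a\<close> and \<open>b\<close>. By condensation, the increment of
  the ratio is \<open>D(u,x,y; e,a,b) D(u; e)\<close> divided by \<open>D(u,x; e,a) D(u,y; e,a)\<close>; the sign rule for these four
  determinants gives its sign.\<close>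

lemma raise_last_exponent_strictly_increasing:
  assumes S: "S \<subseteq> {0..}" and e: "exponents_for S N e"
    and ab: "a < b" "0 \<in> S \<Longrightarrow> 0 \<le> a" "\<And>j. j < N \<Longrightarrow> (a - e j) * (b - e j) > 0"
    and u: "u ` {..<N} \<subseteq> S" "inj_on u {..<N}"
    and xy: "x \<in> S" "y \<in> S" "x < y" "\<And>i. i < N \<Longrightarrow> u i \<noteq> x" "\<And>i. i < N \<Longrightarrow> u i \<noteq> y"
  shows "kernel_det real_pow (Suc N) (u(N := x)) (e(N := b)) /
      kernel_det real_pow (Suc N) (u(N := x)) (e(N := a))
    < kernel_det real_pow (Suc N) (u(N := y)) (e(N := b)) /
      kernel_det real_pow (Suc N) (u(N := y)) (e(N := a))"
proof -
  define F where "F c z = kernel_det real_pow (Suc N) (u(N := z)) (e(N := c))" for c z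
  define G where "G = kernel_det real_pow (Suc (Suc N)) (u(N := x, Suc N := y)) (e(N := a, Suc N := b))"
  define D where "D = kernel_det real_pow N u e"
  define Pu where "Pu z = (\<Prod>k<N. z - u k)" for z
  define Pe where "Pe z = (\<Prod>k<N. z - e k)" for z
  have a_new: "a \<noteq> e j" and b_new: "b \<noteq> e j" if "j < N" for j using ab(3)[OF that] by auto
  have ea: "exponents_for S (Suc N) (e(N := a))"
    using a_new ab(2) by (intro exponents_for_extend e)
  have eab: "exponents_for S (Suc (Suc N)) (e(N := a, Suc N := b))"
    using ab(1,2) b_new by (intro exponents_for_extend ea) (auto simp: less_Suc_eq)
  have image_upd: "(f(K := z)) ` {..<Suc K} \<subseteq> S" if "f ` {..<K} \<subseteq> S" "z \<in> S" for f :: "nat \<Rightarrow> real" and K z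
    using that by (auto simp: less_Suc_eq)
  have ux: "inj_on (u(N := x)) {..<Suc N}" and uy: "inj_on (u(N := y)) {..<Suc N}"
    using u(2) xy(4,5) by (intro inj_on_upd_last; simp)+
  have uxy: "inj_on (u(N := x, Suc N := y)) {..<Suc (Suc N)}"
    using xy(3,5) by (intro inj_on_upd_last ux) (auto simp: less_Suc_eq)
  note images = image_upd[OF u(1)] image_upd[OF image_upd[OF u(1) xy(1)] xy(2)]
  have prod_upd: "(\<Prod>k<Suc N. z - (f(N := w)) k) = (\<Prod>k<N. z - f k) * (z - w)" for z w :: real and f
    by (auto intro!: prod.cong)
  have V_u: "vandermonde_prod (Suc N) (u(N := z)) = vandermonde_prod N u * Pu z" for z
    by (simp add: vandermonde_prod_Suc_upd Pu_def)
  have V_e: "vandermonde_prod (Suc N) (e(N := a)) = vandermonde_prod N e * Pe a"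
    by (simp add: vandermonde_prod_Suc_upd Pe_def)
  have V_uxy: "vandermonde_prod (Suc (Suc N)) (u(N := x, Suc N := y)) =
      vandermonde_prod N u * Pu x * (Pu y * (y - x))"
    by (simp only: vandermonde_prod_Suc_upd prod_upd Pu_def)
  have V_eab: "vandermonde_prod (Suc (Suc N)) (e(N := a, Suc N := b)) =
      vandermonde_prod N e * Pe a * (Pe b * (b - a))"
    by (simp only: vandermonde_prod_Suc_upd prod_upd Pe_def)
  have s1: "G * (vandermonde_prod N u * Pu x * (Pu y * (y - x)))
      * (vandermonde_prod N e * Pe a * (Pe b * (b - a))) > 0"
    using kernel_det_real_pow_sign[OF S eab images(2) uxy] unfolding G_def V_uxy V_eab .
  have s2: "D * vandermonde_prod N u * vandermonde_prod N e > 0"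
    using kernel_det_real_pow_sign[OF S e u] unfolding D_def .
  have s3: "F a z * (vandermonde_prod N u * Pu z) * (vandermonde_prod N e * Pe a) > 0" if "z \<in> {x, y}" for z
    using kernel_det_real_pow_sign[OF S ea images(1) ux] kernel_det_real_pow_sign[OF S ea images(1) uy] xy(1,2) that
    unfolding F_def V_u V_e by blast
  have Pe_ab: "Pe a * Pe b > 0"
    unfolding Pe_def prod.distrib[symmetric] using ab(3) by (intro prod_pos) auto
  have "vandermonde_prod N u \<noteq> 0" "vandermonde_prod N e \<noteq> 0" "Pu x \<noteq> 0" "Pu y \<noteq> 0" "Pe a \<noteq> 0"
    using s3[of x] s3[of y] by auto
  then have weight: "0 < ((vandermonde_prod N u)\<^sup>2 * Pu x * Pu y)\<^sup>2 * (y - x)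
      * (((vandermonde_prod N e)\<^sup>2 * Pe a)\<^sup>2 * (b - a) * (Pe a * Pe b))"
    using xy(3) ab(1)
    by (intro mult_pos_pos[OF mult_pos_pos mult_pos_pos[OF mult_pos_pos Pe_ab]]) auto
  \<comment> \<open>In the product of the four sign rules, the Vandermonde products combine to squares and the
     positive factors \<open>y - x\<close>, \<open>b - a\<close> and \<open>Pe a * Pe b\<close>.\<close>
  have "0 < (G * (vandermonde_prod N u * Pu x * (Pu y * (y - x)))
      * (vandermonde_prod N e * Pe a * (Pe b * (b - a))))
      * (D * vandermonde_prod N u * vandermonde_prod N e)
      * (F a x * (vandermonde_prod N u * Pu x) * (vandermonde_prod N e * Pe a))
      * (F a y * (vandermonde_prod N u * Pu y) * (vandermonde_prod N e * Pe a))"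
    by (rule mult_pos_pos[OF mult_pos_pos[OF mult_pos_pos[OF s1 s2] s3] s3]) auto
  also have "\<dots> = (((vandermonde_prod N u)\<^sup>2 * Pu x * Pu y)\<^sup>2 * (y - x)
      * (((vandermonde_prod N e)\<^sup>2 * Pe a)\<^sup>2 * (b - a) * (Pe a * Pe b)))
      * (G * D * (F a x * F a y))"
    by (simp add: power2_eq_square ac_simps)
  finally have "0 < G * D * (F a x * F a y)"
    using weight by (rule zero_less_mult_pos)
  moreover have nz: "F a x \<noteq> 0" "F a y \<noteq> 0" using s3[of x] s3[of y] by auto
  moreover have "G * D = F a x * F b y - F b x * F a y"
    using kernel_det_condensation[of real_pow N u x e a y b] nz(1) unfolding F_def G_def D_def by blast
  ultimately have "0 < (F a x * F b y - F b x * F a y) / (F a x * F a y)"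
    by (auto simp: zero_less_mult_iff zero_less_divide_iff)
  also have "\<dots> = F b y / F a y - F b x / F a x"
    using nz by (simp add: field_simps)
  finally show ?thesis unfolding F_def by simp
qed

lemma kernel_det_ratio_permute:
  assumes "p permutes {..<N}" "q permutes {..<N}"
  shows "kernel_det k N (u \<circ> p) (e' \<circ> q) / kernel_det k N (u \<circ> p) (e \<circ> q)
    = kernel_det k N u e' / (kernel_det k N u e :: real)"
  by (simp add: kernel_det_permute_rows[OF assms(1)] kernel_det_permute_columns[OF assms(2)] sign_def)

text \<open>Exchanging rows and columns moves the varying point and the raised exponent to the last position; the
  signs cancel in the ratios.\<close>

lemma raise_one_exponent_strictly_increasing:
  assumes S: "S \<subseteq> {0..}" and w: "exponents_for S N w"
    and s: "s < N" "w s < b" "\<And>j. j < N \<Longrightarrow> j \<noteq> s \<Longrightarrow> (w s - w j) * (b - w j) > 0"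
      "0 \<in> S \<Longrightarrow> \<exists>j<N. j \<noteq> s \<and> w j = 0"
    and u: "u ` {..<N} \<subseteq> S" "inj_on u {..<N}" and v: "v ` {..<N} \<subseteq> S" "inj_on v {..<N}"
    and i: "i < N" "u i < v i" "\<And>j. j < N \<Longrightarrow> j \<noteq> i \<Longrightarrow> u j = v j"
  shows "kernel_det real_pow N u (w(s := b)) / kernel_det real_pow N u w
    < kernel_det real_pow N v (w(s := b)) / kernel_det real_pow N v w"
proof -
  obtain M where M: "N = Suc M" using i(1) by (cases N) auto
  define p where "p = transpose i M"
  define q where "q = transpose s M"
  have p: "p permutes {..<N}" and q: "q permutes {..<N}"
    using i(1) s(1) by (auto simp: p_def q_def M intro!: permutes_swap_id)
  have p_less: "p j < N" "p j \<noteq> i" and q_less: "q j < N" "q j \<noteq> s" if "j < M" for j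
    using that i(1) s(1) by (auto simp: p_def q_def M transpose_def)
  have p_inj: "inj p" and q_inj: "inj q" using p q by (auto intro: permutes_inj)
  define U where "U = u \<circ> p"
  define E where "E = w \<circ> q"
  have upd_E: "E(M := b) = w(s := b) \<circ> q" "E(M := w s) = w \<circ> q"
    by (auto simp: E_def q_def transpose_def fun_eq_iff)
  have upd_u: "U(M := u i) = u \<circ> p" by (auto simp: U_def p_def)
  have upd_v: "kernel_det real_pow N (U(M := v i)) f = kernel_det real_pow N (v \<circ> p) f" for f
    using i(3) p_less by (intro kernel_det_cong arg_cong2[of _ _ _ _ real_pow])
      (auto simp: U_def M less_Suc_eq p_def)
  have "kernel_det real_pow (Suc M) (U(M := u i)) (E(M := b)) /
      kernel_det real_pow (Suc M) (U(M := u i)) (E(M := w s))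
    < kernel_det real_pow (Suc M) (U(M := v i)) (E(M := b)) /
      kernel_det real_pow (Suc M) (U(M := v i)) (E(M := w s))"
  proof (rule raise_last_exponent_strictly_increasing[OF S])
    show "exponents_for S M E"
    proof -
      have "inj_on E {..<M}"
        unfolding E_def
        using w q_less by (intro comp_inj_on inj_on_subset[OF q_inj])
          (auto simp: exponents_for_def intro: inj_on_subset)
      moreover have "\<exists>j<M. E j = 0" if zero: "0 \<in> S"
      proof -
        obtain j where "j < N" "j \<noteq> s" "w j = 0" using s(4) zero by blast
        then show ?thesis
          by (intro exI[of _ "if j = M then s else j"]) (use s(1) in \<open>auto simp: M E_def q_def\<close>)
      qed
      ultimately show ?thesis
        using w q_less by (auto simp: exponents_for_def E_def)
    qed
    show "0 \<le> w s" if "0 \<in> S" using w s(1) that by (simp add: exponents_for_def)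
    show "0 < (w s - E j) * (b - E j)" if "j < M" for j
      using s(3) q_less that by (simp add: E_def)
    show "U ` {..<M} \<subseteq> S" using u(1) p_less by (auto simp: U_def)
    show "inj_on U {..<M}"
      unfolding U_def using u(2) p_less
      by (intro comp_inj_on inj_on_subset[OF p_inj]) (auto intro: inj_on_subset)
    show "u i \<in> S" "v i \<in> S" using i(1) u(1) v(1) by auto
    show "U j \<noteq> u i" if "j < M" for j
      using u(2) p_less[OF that] i(1) by (auto simp: U_def inj_on_def)
    show "U j \<noteq> v i" if "j < M" for j
      using v(2) p_less[OF that] i(1) i(3)[of "p j"] by (auto simp: U_def inj_on_def)
  qed (use s i in auto)
  then show ?thesis
    unfolding M[symmetric] upd_E upd_u upd_v kernel_det_ratio_permute[OF p q] .
qed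

text \<open>For increasing exponents, numerator and denominator both have the sign of the Vandermonde product of
  the points.\<close>

lemma kernel_det_ratio_positive:
  assumes S: "S \<subseteq> {0..}" and u: "u ` {..<N} \<subseteq> S" "inj_on u {..<N}"
    and m: "exponents_for S N m" "strict_mono_on {..<N} m"
    and n: "exponents_for S N n" "strict_mono_on {..<N} n"
  shows "kernel_det real_pow N u n / kernel_det real_pow N u m > 0"
proof -
  have "kernel_det real_pow N u m * vandermonde_prod N u > 0" "kernel_det real_pow N u n * vandermonde_prod N u > 0"
    using kernel_det_real_pow_sign[OF S m(1) u] kernel_det_real_pow_sign[OF S n(1) u]
      vandermonde_prod_pos[OF m(2)] vandermonde_prod_pos[OF n(2)] by (simp_all add: zero_less_mult_iff)
  then show ?thesis by (auto simp: zero_less_mult_iff zero_less_divide_iff)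
qed

text \<open>The exponents are raised from \<open>m\<close> to \<open>n\<close> one at a time, the largest one first: then all intermediate
  tuples are increasing, and no exponent passes another one. If 0 is an admissible point, the exponent at
  index 0 stays 0.\<close>

lemma kernel_det_ratio_strictly_increasing:
  assumes S: "S \<subseteq> {0..}"
    and m: "strict_mono_on {..<N} m" and n: "strict_mono_on {..<N} n"
    and le: "\<And>j. j < N \<Longrightarrow> m j \<le> n j" and neq: "\<exists>j<N. m j \<noteq> n j"
    and zero: "0 \<in> S \<Longrightarrow> m 0 = 0 \<and> n 0 = 0"
    and u: "u ` {..<N} \<subseteq> S" "inj_on u {..<N}" and v: "v ` {..<N} \<subseteq> S" "inj_on v {..<N}"
    and i: "i < N" "u i < v i" "\<And>j. j < N \<Longrightarrow> j \<noteq> i \<Longrightarrow> u j = v j"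
  shows "kernel_det real_pow N u n / kernel_det real_pow N u m
    < kernel_det real_pow N v n / kernel_det real_pow N v m"
proof -
  \<comment> \<open>\<open>w s\<close> has the exponents from index \<open>s\<close> on already raised, so \<open>w N\<close> is \<open>m\<close> and \<open>w 0\<close> is \<open>n\<close>.\<close>
  define w where "w s j = (if j < s then m j else n j)" for s j
  have w_mono: "strict_mono_on {..<N} (w s)" for s
  proof (rule strict_mono_onI)
    fix j l assume "j \<in> {..<N}" "l \<in> {..<N}" "j < l"
    then have "m j < m l" "n j < n l" "m l \<le> n l"
      using m n le by (auto simp: strict_mono_on_def)
    then show "w s j < w s l" using \<open>j < l\<close> by (auto simp: w_def)
  qed
  have w_exp: "exponents_for S N (w s)" for s
    using zero i(1) by (intro exponents_for_strict_mono w_mono) (auto simp: w_def)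
  define K where "K x s = kernel_det real_pow N x (w s)" for x s
  have K_m: "K x N = kernel_det real_pow N x m" and K_n: "K x 0 = kernel_det real_pow N x n" for x
    unfolding K_def by (intro kernel_det_cong; simp add: w_def)+
  have nz: "K u s \<noteq> 0" "K v s \<noteq> 0" for s
    unfolding K_def using kernel_det_real_pow_nonzero[OF S w_exp] u v by blast+
  have pos: "K u s / K u s' > 0" "K v s / K v s' > 0" for s s'
    unfolding K_def by (intro kernel_det_ratio_positive[OF S] u v w_exp w_mono)+
  have raise: "K u s / K u (Suc s) < K v s / K v (Suc s)" if s: "s < N" "m s < n s" for s
  proof -
    have w_upd: "w s = (w (Suc s))(s := n s)" by (auto simp: w_def fun_eq_iff)
    show ?thesis
      unfolding K_def w_upd
    proof (rule raise_one_exponent_strictly_increasing[OF S w_exp s(1) _ _ _ u v i])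
      show "w (Suc s) s < n s" using s by (simp add: w_def)
      show "0 < (w (Suc s) s - w (Suc s) j) * (n s - w (Suc s) j)" if j: "j < N" "j \<noteq> s" for j
      proof (cases "j < s")
        case True
        then have "m j < m s" using m s(1) by (auto simp: strict_mono_on_def)
        then show ?thesis using True s by (auto simp: w_def intro: mult_pos_pos)
      next
        case False
        then have "n s < n j" using n j s(1) by (auto simp: strict_mono_on_def)
        then show ?thesis using False j s by (auto simp: w_def intro: mult_neg_neg)
      qed
      show "\<exists>j<N. j \<noteq> s \<and> w (Suc s) j = 0" if "0 \<in> S"
        using zero[OF that] s by (intro exI[of _ 0]) (auto simp: w_def intro: gr0I)
    qed
  qed
  have triv: "K x s = K x (Suc s)" if "\<not> m s < n s" "s < N" for x s
    using that le[of s] unfolding K_def by (intro kernel_det_cong) (auto simp: w_def less_Suc_eq)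
  have split: "K x s / K x N = K x s / K x (Suc s) * (K x (Suc s) / K x N)" if "K x (Suc s) \<noteq> 0" for x s
    using that by simp
  have chain: "K u s / K u N \<le> K v s / K v N \<and>
      ((\<exists>j<N. s \<le> j \<and> m j \<noteq> n j) \<longrightarrow> K u s / K u N < K v s / K v N)" if "s \<le> N" for s
    using that
  proof (induction s rule: inc_induct)
    case base
    then show ?case using nz by simp
  next
    case (step s)
    show ?case
    proof (cases "m s < n s")
      case True
      have "K u s / K u (Suc s) * (K u (Suc s) / K u N) < K v s / K v (Suc s) * (K v (Suc s) / K v N)"
        using raise[OF _ True] step pos by (intro mult_less_le_imp_less) (auto intro: less_imp_le)
      then have "K u s / K u N < K v s / K v N"
        by (simp only: split[OF nz(1)[of "Suc s"]] split[OF nz(2)[of "Suc s"]])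
      then show ?thesis by simp
    next
      case False
      then have "m s = n s" using le[of s] step.hyps by linarith
      then have "(\<exists>j<N. s \<le> j \<and> m j \<noteq> n j) \<longleftrightarrow> (\<exists>j<N. Suc s \<le> j \<and> m j \<noteq> n j)"
        by (metis Suc_leD le_antisym not_less_eq_eq)
      moreover have "K x s = K x (Suc s)" for x using triv[OF False] step.hyps by simp
      ultimately show ?thesis using step.IH by simp
    qed
  qed
  from chain[of 0] neq show ?thesis unfolding K_m K_n by auto
qed

section \<open>The upper bound\<close>

text \<open>With points in geometric progression, exchanging rows and columns gives a Vandermonde matrix up to
  scaling.\<close>

lemma kernel_det_geometric_points:
  assumes "s > 0" "r > 1" "inj_on e {..<N}"
  shows "kernel_det real_pow N (\<lambda>i. s * r ^ i) e = (\<Prod>j<N. s powr e j) * vandermonde_prod N (\<lambda>j. r powr e j)"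
proof -
  have pow: "real_pow (s * r ^ i) y = s powr y * (r powr y) ^ i" for i y
    using assms(1,2)
    by (simp add: real_pow_pos powr_mult powr_realpow[symmetric] powr_powr mult.commute)
  have "kernel_det real_pow N (\<lambda>i. s * r ^ i) e = kernel_det (\<lambda>y x. real_pow x y) N e (\<lambda>i. s * r ^ i)"
    by (rule kernel_det_swap_arguments)
  also have "\<dots> = kernel_det (\<lambda>y i. s powr y * (r powr y) ^ i) N e id"
    by (intro kernel_det_cong) (simp add: pow)
  also have "\<dots> = (\<Prod>j<N. s powr e j) * kernel_det (\<lambda>y i. (r powr y) ^ i) N e id"
    by (rule kernel_det_scale_rows)
  also have "kernel_det (\<lambda>y i. (r powr y) ^ i) N e id = kernel_det (^) N (\<lambda>j. r powr e j) id"
    by (intro kernel_det_cong) simp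
  also have "\<dots> = vandermonde_prod N (\<lambda>j. r powr e j)"
    using assms(2,3) by (intro kernel_det_Vandermonde) (auto simp: inj_on_def powr_inj)
  finally show ?thesis .
qed

lemma powr_difference_quotient_tendsto:
  "((\<lambda>r::real. (r powr a - r powr b) / (r - 1)) \<longlongrightarrow> a - b) (at 1)"
proof -
  have "((\<lambda>r::real. r powr a - r powr b) has_real_derivative a - b) (at 1)"
    using DERIV_diff[OF has_real_derivative_powr[of 1 a] has_real_derivative_powr[of 1 b]] by simp
  then show ?thesis by (simp add: has_field_derivative_iff)
qed

text \<open>Numerator and denominator have equally many factors, and each of them vanishes at 1. Divided by
  \<open>r - 1\<close>, a factor tends to the derivative at 1 of its difference of powers.\<close>

lemma vandermonde_prod_powr_ratio_tendsto:
  assumes "inj_on m {..<N}"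
  shows "((\<lambda>r. vandermonde_prod N (\<lambda>j. r powr n j) / vandermonde_prod N (\<lambda>j. r powr m j))
    \<longlongrightarrow> vandermonde_prod N n / vandermonde_prod N m) (at_right 1)"
proof -
  have "((\<lambda>r::real. (r powr a - r powr b) / (r powr c - r powr d)) \<longlongrightarrow> (a - b) / (c - d)) (at_right 1)"
    if "c \<noteq> d" for a b c d :: real
  proof -
    have "((\<lambda>r::real. ((r powr a - r powr b) / (r - 1)) / ((r powr c - r powr d) / (r - 1)))
        \<longlongrightarrow> (a - b) / (c - d)) (at_right 1)"
      using that by (intro tendsto_divide tendsto_within_subset[OF powr_difference_quotient_tendsto]) auto
    then show ?thesis
      by (rule Lim_transform_eventually) (auto simp: eventually_at_filter)
  qed
  moreover have "m l \<noteq> m k" if "l < N" "k < l" for k l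
    using assms that by (force simp: inj_on_def)
  ultimately show ?thesis
    unfolding vandermonde_prod_def prod_dividef[symmetric] by (intro tendsto_prod) auto
qed

text \<open>The points are moved one after the other to those of a geometric progression above \<open>R\<close>. Since the new
  points exceed all old ones, no two points collide on the way, whatever the order of \<open>u\<close>.\<close>

lemma kernel_det_ratio_bound:
  assumes S: "S \<subseteq> {0..}" "{0<..} \<subseteq> S"
    and m: "strict_mono_on {..<N} m" and n: "strict_mono_on {..<N} n"
    and le: "\<And>j. j < N \<Longrightarrow> m j \<le> n j" and neq: "\<exists>j<N. m j \<noteq> n j"
    and zero: "0 \<in> S \<Longrightarrow> m 0 = 0 \<and> n 0 = 0"
    and u: "u ` {..<N} \<subseteq> S" "inj_on u {..<N}" "\<And>i. i < N \<Longrightarrow> u i \<le> R" and R: "R > 0"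
  shows "kernel_det real_pow N u n / kernel_det real_pow N u m
    \<le> R powr (\<Sum>j<N. n j - m j) * (vandermonde_prod N n / vandermonde_prod N m)"
proof -
  define F where "F x = kernel_det real_pow N x n / kernel_det real_pow N x m" for x
  have inj: "inj_on m {..<N}" "inj_on n {..<N}"
    using m n by (auto intro: strict_mono_on_imp_inj_on)
  have below: "F u \<le> (\<Prod>j<N. (R * r) powr (n j - m j)) *
        (vandermonde_prod N (\<lambda>j. r powr n j) / vandermonde_prod N (\<lambda>j. r powr m j))"
    if r: "r > 1" for r
  proof -
    \<comment> \<open>The factor \<open>r\<close> pushes also the first point beyond \<open>R\<close>, which may itself be one of the \<open>u i\<close>.\<close>
    define p where "p i = (R * r) * r ^ i" for i :: nat
    define h where "h t i = (if i < t then p i else u i)" for t i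
    have p_gt: "p i > R" for i
    proof -
      have "R * 1 < R * (r * r ^ i)"
        using R r by (intro mult_strict_left_mono one_less_power[of r "Suc i", simplified]) auto
      then show ?thesis by (simp add: p_def mult.assoc)
    qed
    have p_neq: "p i \<noteq> p j" if "i \<noteq> j" for i j
      using that R r by (auto simp: p_def power_inject_exp)
    have h_points: "h t ` {..<N} \<subseteq> S" "inj_on (h t) {..<N}" for t
    proof -
      have "p i \<in> S" for i using p_gt[of i] R S(2) by auto
      then show "h t ` {..<N} \<subseteq> S" using u(1) by (auto simp: h_def)
      have "u i \<noteq> p j" if "i < N" for i j using p_gt[of j] u(3)[OF that] by simp
      then show "inj_on (h t) {..<N}"
        using p_neq inj_onD[OF u(2)] unfolding h_def
        by (intro inj_onI) (metis lessThan_iff)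
    qed
    have "F u \<le> F (h t)" if "t \<le> N" for t
      using that
    proof (induction t)
      case 0
      have "h 0 = u" by (simp add: h_def fun_eq_iff)
      then show ?case by simp
    next
      case (Suc t)
      have "F (h t) < F (h (Suc t))"
        unfolding F_def
      proof (rule kernel_det_ratio_strictly_increasing[OF S(1) m n le neq zero h_points h_points])
        show "h t t < h (Suc t) t" using p_gt[of t] u(3)[of t] Suc.prems by (simp add: h_def)
        show "h t j = h (Suc t) j" if "j \<noteq> t" for j using that by (simp add: h_def)
      qed (use Suc.prems in auto)
      then show ?case using Suc by simp
    qed
    then have "F u \<le> F (h N)" by blast
    also have "F (h N) = F p"
      unfolding F_def by (intro arg_cong2[of _ _ _ _ "(/)"] kernel_det_cong) (auto simp: h_def)
    also have "F p = (\<Prod>j<N. (R * r) powr (n j - m j)) *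
        (vandermonde_prod N (\<lambda>j. r powr n j) / vandermonde_prod N (\<lambda>j. r powr m j))"
      unfolding F_def p_def using R r inj
      by (simp add: kernel_det_geometric_points powr_diff prod_dividef)
    finally show ?thesis .
  qed
  have "((\<lambda>r. (\<Prod>j<N. (R * r) powr (n j - m j)) *
        (vandermonde_prod N (\<lambda>j. r powr n j) / vandermonde_prod N (\<lambda>j. r powr m j)))
      \<longlongrightarrow> (\<Prod>j<N. (R * 1) powr (n j - m j)) * (vandermonde_prod N n / vandermonde_prod N m)) (at_right 1)"
    using R by (intro tendsto_mult tendsto_prod vandermonde_prod_powr_ratio_tendsto inj tendsto_powr
        tendsto_const tendsto_ident_at) auto
  then have "F u \<le> (\<Prod>j<N. (R * 1) powr (n j - m j)) * (vandermonde_prod N n / vandermonde_prod N m)"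
    by (rule tendsto_lowerbound) (use below in \<open>auto simp: eventually_at_filter\<close>)
  also have "(\<Prod>j<N. (R * 1) powr (n j - m j)) = R powr (\<Sum>j<N. n j - m j)"
    using R by (simp add: powr_sum)
  finally show ?thesis unfolding F_def .
qed

section \<open>The determinant ratio\<close>

lemma det_circ_power:
  assumes "u \<in> carrier_vec N" "e \<in> carrier_vec N"
  shows "det (circ_power u e) = kernel_det real_pow N (\<lambda>i. u $ i) (\<lambda>j. e $ j)"
  using assms by (simp add: circ_power_def kernel_det_def)

lemma distinct_tuplesD:
  assumes "u \<in> distinct_tuples N S"
  shows "u \<in> carrier_vec N" "(\<lambda>i. u $ i) ` {..<N} \<subseteq> S" "inj_on (\<lambda>i. u $ i) {..<N}"
  using assms by (auto simp: distinct_tuples_def inj_on_def)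

theorem theorem2p9:
  fixes N :: nat and m n :: "real vec"
  assumes "N \<ge> 1"
    and "m \<in> carrier_vec N" and "n \<in> carrier_vec N"
    and "strict_mono_on {..<N} (\<lambda>j. m $ j)" and "strict_mono_on {..<N} (\<lambda>j. n $ j)"
    and "m \<noteq> n"
    and "\<forall>j<N. m $ j \<le> n $ j"
  shows
    "(\<forall>u \<in> distinct_tuples N {0<..}. det (circ_power u m) \<noteq> 0) \<and>
     symmetric_on N (distinct_tuples N {0<..}) (det_ratio n m) \<and>
     strictly_increasing_coords N (distinct_tuples N {0<..}) (det_ratio n m) \<and>
     (\<forall>\<rho>>0. \<forall>u \<in> distinct_tuples N {0<..sqrt \<rho>}.
        det_ratio n m u \<le> \<rho> powr (tuple_diff n m / 2) * vandermonde n / vandermonde m) \<and>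
     (m $ 0 = 0 \<and> n $ 0 = 0 \<longrightarrow>
       (\<forall>\<rho>>0.
         (\<forall>u \<in> distinct_tuples N {0..sqrt \<rho>}. det (circ_power u m) \<noteq> 0) \<and>
         strictly_increasing_coords N (distinct_tuples N {0..sqrt \<rho>}) (det_ratio n m) \<and>
         (\<forall>u \<in> distinct_tuples N {0..sqrt \<rho>}.
            det_ratio n m u \<le> \<rho> powr (tuple_diff n m / 2) * vandermonde n / vandermonde m)))"
proof -
  let ?m = "\<lambda>j. m $ j" and ?n = "\<lambda>j. n $ j"
  have le: "?m j \<le> ?n j" if "j < N" for j using assms(7) that by blast
  have neq: "\<exists>j<N. ?m j \<noteq> ?n j" using assms(2,3,6) by (auto simp: vec_eq_iff)
  have ratio: "det_ratio n m u = kernel_det real_pow N (\<lambda>i. u $ i) ?n / kernel_det real_pow N (\<lambda>i. u $ i) ?m"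
    if "u \<in> carrier_vec N" for u
    using that assms(2,3) by (simp add: det_ratio_def det_circ_power)
  have nonzero: "det (circ_power u m) \<noteq> 0"
    if S: "S \<subseteq> {0..}" "0 \<in> S \<Longrightarrow> ?m 0 = 0" and u: "u \<in> distinct_tuples N S" for u S
  proof -
    have "exponents_for S N ?m"
      using S(2) assms(1) by (intro exponents_for_strict_mono assms(4)) auto
    then show ?thesis
      using kernel_det_real_pow_nonzero[OF S(1)] distinct_tuplesD[OF u] assms(2)
      by (simp add: det_circ_power)
  qed
  have increasing: "strictly_increasing_coords N (distinct_tuples N S) (det_ratio n m)"
    if S: "S \<subseteq> {0..}" "0 \<in> S \<Longrightarrow> ?m 0 = 0 \<and> ?n 0 = 0" for S
    unfolding strictly_increasing_coords_def
  proof (intro ballI allI impI, elim conjE)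
    fix u v i
    assume u: "u \<in> distinct_tuples N S" and v: "v \<in> distinct_tuples N S" and "i < N"
      "u $ i < v $ i" "\<forall>j<N. j \<noteq> i \<longrightarrow> u $ j = v $ j"
    then show "det_ratio n m u < det_ratio n m v"
      unfolding ratio[OF distinct_tuplesD(1)[OF u]] ratio[OF distinct_tuplesD(1)[OF v]]
      by (intro kernel_det_ratio_strictly_increasing[OF S(1) assms(4,5) le neq S(2)
            distinct_tuplesD(2,3)[OF u] distinct_tuplesD(2,3)[OF v]]) auto
  qed
  have bound: "det_ratio n m u \<le> \<rho> powr (tuple_diff n m / 2) * vandermonde n / vandermonde m"
    if S: "S \<subseteq> {0..}" "{0<..} \<subseteq> S" "0 \<in> S \<Longrightarrow> ?m 0 = 0 \<and> ?n 0 = 0" and \<rho>: "\<rho> > 0"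
      and u: "u \<in> distinct_tuples N S" "\<forall>i<N. u $ i \<le> sqrt \<rho>" for u \<rho> S
  proof -
    have "det_ratio n m u \<le> sqrt \<rho> powr (\<Sum>j<N. ?n j - ?m j) * (vandermonde_prod N ?n / vandermonde_prod N ?m)"
      unfolding ratio[OF distinct_tuplesD(1)[OF u(1)]]
      by (rule kernel_det_ratio_bound[OF S(1,2) assms(4,5) le neq S(3) distinct_tuplesD(2,3)[OF u(1)]])
        (use u(2) \<rho> in auto)
    also have "sqrt \<rho> powr (\<Sum>j<N. ?n j - ?m j) = \<rho> powr (tuple_diff n m / 2)"
      using \<rho> assms(3) by (simp add: tuple_diff_def powr_half_sqrt[symmetric] powr_powr)
    finally show ?thesis
      using assms(2,3) by (simp add: vandermonde_def vandermonde_prod_def)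
  qed
  have symmetric: "symmetric_on N (distinct_tuples N {0<..}) (det_ratio n m)"
    unfolding symmetric_on_def
  proof (intro ballI allI impI)
    fix u \<sigma> assume u: "u \<in> distinct_tuples N {0<..}" and \<sigma>: "\<sigma> permutes {..<N}"
    have perm: "kernel_det real_pow N (\<lambda>i. vec N (\<lambda>i. u $ \<sigma> i) $ i) e
        = kernel_det real_pow N ((\<lambda>i. u $ i) \<circ> \<sigma>) e" for e
      by (intro kernel_det_cong) auto
    show "det_ratio n m (vec N (\<lambda>i. u $ \<sigma> i)) = det_ratio n m u"
      unfolding ratio[OF vec_carrier] ratio[OF distinct_tuplesD(1)[OF u]] perm
      using kernel_det_ratio_permute[OF \<sigma> permutes_id, of real_pow "\<lambda>i. u $ i" ?n ?m] by simp
  qed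
  have enlarge: "u \<in> distinct_tuples N T \<and> (\<forall>i<N. u $ i \<le> sqrt \<rho>)"
    if "u \<in> distinct_tuples N U" "U \<subseteq> T" "U \<subseteq> {..sqrt \<rho>}" for u \<rho> U T
    using that by (auto simp: distinct_tuples_def)
  have pos_bound: "det_ratio n m u \<le> \<rho> powr (tuple_diff n m / 2) * vandermonde n / vandermonde m"
    if "\<rho> > 0" "u \<in> distinct_tuples N {0<..sqrt \<rho>}" for u \<rho>
    by (rule bound[of "{0<..}"])
      (use enlarge[OF that(2), of "{0<..}" \<rho>] that in \<open>auto simp: subset_iff\<close>)
  have zero_bound: "det_ratio n m u \<le> \<rho> powr (tuple_diff n m / 2) * vandermonde n / vandermonde m"
    if "m $ 0 = 0 \<and> n $ 0 = 0" "\<rho> > 0" "u \<in> distinct_tuples N {0..sqrt \<rho>}" for u \<rho>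
    by (rule bound[of "{0..}"])
      (use enlarge[OF that(3), of "{0..}" \<rho>] that in \<open>auto simp: subset_iff\<close>)
  show ?thesis
    using nonzero[of "{0<..}"] nonzero[of "{0..sqrt _}"] symmetric increasing[of "{0<..}"]
      increasing[of "{0..sqrt _}"] pos_bound zero_bound
    by (intro conjI impI allI ballI) (simp_all add: subset_iff)
qed

end
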